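(* Let $M$ be a compact 3-manifold with non-empty boundary, let $\mathcal T$ be an ideal triangulation of its interior with $N$ tetrahedra and $N$ edges, and let $c:\mathcal T^1\to\mathbb C^\ast$ be a Ptolemy assignment on $\mathcal T$. Then $c$ lifts to a super-Ptolemy assignment $(c,\theta)$ with $\theta\neq 0$ (over the Grassmann algebra with one odd generator) if and only if $\delta_{\mathcal T,c,2}(1)=0$.
   Context: Ptolemy assignment: $\mathcal T^1$ denotes the oriented edges and $\mathcal T^2$ the unoriented faces of $\mathcal T$. A Ptolemy assignment is a map $c:\mathcal T^1\to\mathbb C^\ast$ with $c(-e)=-c(e)$ and, for each tetrahedron with vertices labelled $0,1,2,3$, $c_{01}c_{23}-c_{02}c_{13}+c_{03}c_{12}=0$, where $c_{ij}=c([i,j])$. Face-equations: for a tetrahedron $\Delta$ with vertices $0,1,2,3$ let $f_k$ be the face opposite to vertex $k$, and $\theta_k=\theta(f_k)$. The four face-equations of $\Delta$, one for each face, are $E_{\Delta,f_3}: c_{12}\theta_0-c_{02}\theta_1+c_{01}\theta_2=0$, $E_{\Delta,f_2}: c_{13}\theta_0-c_{03}\theta_1+c_{01}\theta_3=0$, $E_{\Delta,f_1}: c_{23}\theta_0-c_{03}\theta_2+c_{02}\theta_3=0$, $E_{\Delta,f_0}: c_{23}\theta_1-c_{13}\theta_2+c_{12}\theta_3=0$. (Relabelling the vertices of $\Delta$ changes each equation at most by a sign.) Super-Ptolemy assignment: the Grassmann algebra with one odd generator is $\mathbb C[\epsilon]/(\epsilon^2)$, with even part $\mathbb C$ and odd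 part $\mathbb C\epsilon\cong\mathbb C$. Over it, a super-Ptolemy assignment on $\mathcal T$ is a pair $(c,\theta)$ consisting of a Ptolemy assignment $c:\mathcal T^1\to\mathbb C^\ast$ and a map $\theta:\mathcal T^2\to\mathbb C$ satisfying all four face-equations for every tetrahedron of $\mathcal T$. 1-loop invariant: $\mathcal T$ has $N$ tetrahedra, $N$ edges and $2N$ faces. Choose an edge $e_\Delta$ of each tetrahedron $\Delta$ and keep only the two face-equations of $\Delta$ corresponding to the two faces of $\Delta$ that contain $e_\Delta$. The resulting $2N$ linear equations in the $2N$ unknowns $\theta(f)$ have a $2N\times2N$ coefficient matrix $F_c$. With $c_1,\dots,c_N$ the values of $c$ on the $N$ edges, $$\delta_{\mathcal T,c,2}(1)=\frac{1}{c_1\cdots c_N}\Big(\prod_\Delta\frac{1}{c(e_\Delta)}\Big)\det F_c,$$ which is well defined up to sign and does not depend on the choice of the edges $e_\Delta$. (This is the value at $t=1$ of a polynomial $\delta_{\mathcal T,c,2}(t)$ built from a $t$-twisted version $F_c(t)$ of $F_c$ with $F_c(1)=F_c$.) *)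

theory Defs
  imports "HOL-Analysis.Analysis" "Jordan_Normal_Form.Determinant"
begin

section \<open>Compact 3-manifolds with boundary\<close>

definition half_space3 :: "(real^3) set" where
  "half_space3 = {x. 0 \<le> x \<bullet> axis 3 1}"

definition compact_3manifold_with_boundary :: "'a topology \<Rightarrow> bool" where
  "compact_3manifold_with_boundary M \<longleftrightarrow>
     compact_space M \<and> Hausdorff_space M \<and> second_countable M \<and>
     (\<forall>p \<in> topspace M. \<exists>U W. openin M U \<and> p \<in> U \<and> openin (top_of_set half_space3) W \<and>
        subtopology M U homeomorphic_space top_of_set W)"

definition manifold_interior :: "'a topology \<Rightarrow> 'a set" where
  "manifold_interior M =
     {p \<in> topspace M. \<exists>U (W :: (real^3) set). openin M U \<and> p \<in> U \<and> open W \<and>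
        subtopology M U homeomorphic_space top_of_set W}"

definition manifold_boundary :: "'a topology \<Rightarrow> 'a set" where
  "manifold_boundary M = topspace M - manifold_interior M"


section \<open>Ideal triangulations\<close>

text \<open>
  The vertices of every tetrahedron are labelled by the four elements \<open>0, 1, 2, 3\<close> of the type
  \<open>4\<close>; the face \<open>k\<close> of a tetrahedron is the one opposite to its vertex \<open>k\<close>.
  If \<open>glue T \<Delta> k = (\<Delta>', \<sigma>)\<close>, then the face \<open>k\<close> of \<open>\<Delta>\<close> is glued to the
  face \<open>\<sigma> k\<close> of \<open>\<Delta>'\<close> by the affine map that sends the vertex \<open>v \<noteq> k\<close> of \<open>\<Delta>\<close> to the
  vertex \<open>\<sigma> v\<close> of \<open>\<Delta>'\<close>.
\<close>

record 't triangulation =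
  tets :: "'t set"
  glue :: "'t \<Rightarrow> 4 \<Rightarrow> 't \<times> (4 \<Rightarrow> 4)"

definition gluing_data :: "'t triangulation \<Rightarrow> bool" where
  "gluing_data T \<longleftrightarrow> finite (tets T) \<and>
     (\<forall>\<Delta> \<in> tets T. \<forall>k \<Delta>' \<sigma>. glue T \<Delta> k = (\<Delta>', \<sigma>) \<longrightarrow>
        \<Delta>' \<in> tets T \<and> bij \<sigma> \<and> (\<Delta>', \<sigma> k) \<noteq> (\<Delta>, k) \<and> glue T \<Delta>' (\<sigma> k) = (\<Delta>, inv_into UNIV \<sigma>))"

text \<open>Barycentric coordinates; the four vertices are removed.\<close>

definition ideal_simplex :: "(4 \<Rightarrow> real) set" where
  "ideal_simplex = {x. (\<forall>i. 0 \<le> x i) \<and> (\<Sum>i\<in>UNIV. x i) = 1 \<and> (\<forall>i. x i \<noteq> 1)}"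

definition ideal_tetrahedra :: "'t triangulation \<Rightarrow> ('t \<times> (4 \<Rightarrow> real)) topology" where
  "ideal_tetrahedra T = prod_topology (discrete_topology (tets T)) (top_of_set ideal_simplex)"

definition point_gluing :: "'t triangulation \<Rightarrow> ('t \<times> (4 \<Rightarrow> real)) rel" where
  "point_gluing T =
     {((\<Delta>, x), (\<Delta>', y)). \<Delta> \<in> tets T \<and> x \<in> ideal_simplex \<and>
        (\<exists>k \<sigma>. glue T \<Delta> k = (\<Delta>', \<sigma>) \<and> x k = 0 \<and> (\<forall>v. y (\<sigma> v) = x v))}"

text \<open>
  The space \<open>X\<close> is homeomorphic to the quotient of the disjoint union of the ideal tetrahedra by
  the face gluings; the relation \<open>point_gluing T\<close> is symmetric, so its reflexive transitive closure
  is the equivalence relation it generates.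
\<close>

definition ideal_triangulation_of :: "'t triangulation \<Rightarrow> 'a topology \<Rightarrow> bool" where
  "ideal_triangulation_of T X \<longleftrightarrow> gluing_data T \<and>
     (\<exists>q. quotient_map (ideal_tetrahedra T) X q \<and>
        (\<forall>p \<in> topspace (ideal_tetrahedra T). \<forall>p' \<in> topspace (ideal_tetrahedra T).
           q p = q p' \<longleftrightarrow> (p, p') \<in> (point_gluing T)\<^sup>*))"


section \<open>Faces and edges\<close>

text \<open>
  A face of the triangulation is the set of the two glued tetrahedron faces it consists of.  An
  oriented edge is the set of all \<open>(\<Delta>, i, j)\<close>, meaning the edge of \<open>\<Delta>\<close> from vertex \<open>i\<close> to
  vertex \<open>j\<close>, that are identified with each other; again the relation is symmetric.
\<close>

type_synonym 't face = "('t \<times> 4) set"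
type_synonym 't oedge = "('t \<times> 4 \<times> 4) set"

definition tface :: "'t triangulation \<Rightarrow> 't \<Rightarrow> 4 \<Rightarrow> 't face" where
  "tface T \<Delta> k = (case glue T \<Delta> k of (\<Delta>', \<sigma>) \<Rightarrow> {(\<Delta>, k), (\<Delta>', \<sigma> k)})"

definition faces :: "'t triangulation \<Rightarrow> 't face set" where
  "faces T = {tface T \<Delta> k | \<Delta> k. \<Delta> \<in> tets T}"

definition edge_gluing :: "'t triangulation \<Rightarrow> ('t \<times> 4 \<times> 4) rel" where
  "edge_gluing T =
     {((\<Delta>, i, j), (\<Delta>', \<sigma> i, \<sigma> j)) | \<Delta> i j k \<Delta>' \<sigma>.
        \<Delta> \<in> tets T \<and> glue T \<Delta> k = (\<Delta>', \<sigma>) \<and> i \<noteq> j \<and> i \<noteq> k \<and> j \<noteq> k}"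

definition oedge :: "'t triangulation \<Rightarrow> 't \<Rightarrow> 4 \<Rightarrow> 4 \<Rightarrow> 't oedge" where
  "oedge T \<Delta> i j = (edge_gluing T)\<^sup>* `` {(\<Delta>, i, j)}"

definition oedges :: "'t triangulation \<Rightarrow> 't oedge set" where
  "oedges T = {oedge T \<Delta> i j | \<Delta> i j. \<Delta> \<in> tets T \<and> i \<noteq> j}"

definition rev_edge :: "'t oedge \<Rightarrow> 't oedge" where
  "rev_edge e = (\<lambda>(\<Delta>, i, j). (\<Delta>, j, i)) ` e"

definition edges :: "'t triangulation \<Rightarrow> 't oedge set set" where
  "edges T = {{e, rev_edge e} | e. e \<in> oedges T}"


section \<open>Ptolemy and super-Ptolemy assignments\<close>

text \<open>Only the values of \<open>c\<close> on \<open>oedges T\<close> and those of \<open>\<theta>\<close> on \<open>faces T\<close> matter.\<close>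

definition ptolemy_assignment :: "'t triangulation \<Rightarrow> ('t oedge \<Rightarrow> complex) \<Rightarrow> bool" where
  "ptolemy_assignment T c \<longleftrightarrow>
     (\<forall>e \<in> oedges T. c e \<noteq> 0 \<and> c (rev_edge e) = - c e) \<and>
     (\<forall>\<Delta> \<in> tets T. let C = (\<lambda>i j. c (oedge T \<Delta> i j)) in
        C 0 1 * C 2 3 - C 0 2 * C 1 3 + C 0 3 * C 1 2 = 0)"

text \<open>
  The left-hand side of the face-equation of \<open>\<Delta>\<close> for its face \<open>k\<close>, as a linear form in the four
  values \<open>x 0, x 1, x 2, x 3\<close> attached to the faces of \<open>\<Delta>\<close>.
\<close>

definition face_form ::
  "'t triangulation \<Rightarrow> ('t oedge \<Rightarrow> complex) \<Rightarrow> 't \<Rightarrow> 4 \<Rightarrow> (4 \<Rightarrow> complex) \<Rightarrow> complex" where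
  "face_form T c \<Delta> k x = (let C = (\<lambda>i j. c (oedge T \<Delta> i j)) in
     if k = 3 then C 1 2 * x 0 - C 0 2 * x 1 + C 0 1 * x 2
     else if k = 2 then C 1 3 * x 0 - C 0 3 * x 1 + C 0 1 * x 3
     else if k = 1 then C 2 3 * x 0 - C 0 3 * x 2 + C 0 2 * x 3
     else C 2 3 * x 1 - C 1 3 * x 2 + C 1 2 * x 3)"

definition face_equation ::
  "'t triangulation \<Rightarrow> ('t oedge \<Rightarrow> complex) \<Rightarrow> ('t face \<Rightarrow> complex) \<Rightarrow> 't \<Rightarrow> 4 \<Rightarrow> bool" where
  "face_equation T c \<theta> \<Delta> k \<longleftrightarrow> face_form T c \<Delta> k (\<lambda>l. \<theta> (tface T \<Delta> l)) = 0"

text \<open>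
  Over \<open>\<complex>[\<epsilon>]/(\<epsilon>\<^sup>2)\<close> the odd part \<open>\<complex>\<epsilon>\<close> is identified with \<open>\<complex>\<close>, so \<open>\<theta>\<close> is complex-valued.
\<close>

definition super_ptolemy_assignment ::
  "'t triangulation \<Rightarrow> ('t oedge \<Rightarrow> complex) \<Rightarrow> ('t face \<Rightarrow> complex) \<Rightarrow> bool" where
  "super_ptolemy_assignment T c \<theta> \<longleftrightarrow>
     ptolemy_assignment T c \<and> (\<forall>\<Delta> \<in> tets T. \<forall>k. face_equation T c \<theta> \<Delta> k)"


section \<open>The 1-loop invariant at 1\<close>

text \<open>
  The invariant is only defined up to sign, so it is a function of the auxiliary choices: an edge
  \<open>a \<Delta>\<close> of each tetrahedron \<open>\<Delta>\<close> (given with an orientation), an orientation \<open>u\<close> of each edge of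
  the triangulation, and numberings \<open>r\<close> of the kept face-equations and \<open>s\<close> of the faces.
\<close>

definition edge_choice :: "'t triangulation \<Rightarrow> ('t \<Rightarrow> 4 \<times> 4) \<Rightarrow> bool" where
  "edge_choice T a \<longleftrightarrow> (\<forall>\<Delta> \<in> tets T. fst (a \<Delta>) \<noteq> snd (a \<Delta>))"

definition edge_orientation :: "'t triangulation \<Rightarrow> ('t oedge set \<Rightarrow> 't oedge) \<Rightarrow> bool" where
  "edge_orientation T u \<longleftrightarrow> (\<forall>E \<in> edges T. u E \<in> E)"

text \<open>A face of \<open>\<Delta>\<close> contains the edge \<open>a \<Delta>\<close> iff the vertex opposite to it is no endpoint.\<close>

definition kept_equations :: "'t triangulation \<Rightarrow> ('t \<Rightarrow> 4 \<times> 4) \<Rightarrow> ('t \<times> 4) set" where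
  "kept_equations T a = {(\<Delta>, k). \<Delta> \<in> tets T \<and> k \<noteq> fst (a \<Delta>) \<and> k \<noteq> snd (a \<Delta>)}"

text \<open>
  The coefficient of the unknown \<open>\<theta> f\<close> in an equation is the value of its linear form at the
  indicator of \<open>f\<close>; coefficients add up if two faces of one tetrahedron are glued to each other.
\<close>

definition face_matrix ::
  "'t triangulation \<Rightarrow> ('t oedge \<Rightarrow> complex) \<Rightarrow> (nat \<Rightarrow> 't \<times> 4) \<Rightarrow> (nat \<Rightarrow> 't face) \<Rightarrow> complex mat"
where
  "face_matrix T c r s = Matrix.mat (2 * card (tets T)) (2 * card (tets T))
     (\<lambda>(m, n). case r m of (\<Delta>, k) \<Rightarrow>
        face_form T c \<Delta> k (\<lambda>l. if tface T \<Delta> l = s n then 1 else 0))"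

definition one_loop_at_1 ::
  "'t triangulation \<Rightarrow> ('t oedge \<Rightarrow> complex) \<Rightarrow> ('t \<Rightarrow> 4 \<times> 4) \<Rightarrow> ('t oedge set \<Rightarrow> 't oedge) \<Rightarrow>
     (nat \<Rightarrow> 't \<times> 4) \<Rightarrow> (nat \<Rightarrow> 't face) \<Rightarrow> complex" where
  "one_loop_at_1 T c a u r s =
     1 / (\<Prod>E \<in> edges T. c (u E)) *
     (\<Prod>\<Delta> \<in> tets T. 1 / c (oedge T \<Delta> (fst (a \<Delta>)) (snd (a \<Delta>)))) *
     Determinant.det (face_matrix T c r s)"

end

theory Submission
  imports Defs
begin

text \<open>
  Solving the two face-equations of a tetrahedron at an edge \<open>e\<close> requires dividing only by
  \<open>c e \<noteq> 0\<close>; the Ptolemy relation then makes the other two face-equations consequences.  Hence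
  the kernel of the square matrix consists exactly of the super-Ptolemy lifts, and the remaining
  factors of the invariant do not vanish.
\<close>

lemma oedge_nonzero:
  assumes "ptolemy_assignment T c" "\<Delta> \<in> tets T" "i \<noteq> j"
  shows "c (oedge T \<Delta> i j) \<noteq> 0"
  using assms unfolding ptolemy_assignment_def oedges_def by blast

lemma exhaust_4_from_0:
  fixes k :: 4
  obtains "k = 0" | "k = 1" | "k = 2" | "k = 3"
  using exhaust_4[of k] by auto

text \<open>The four face-forms satisfy one linear relation for each vertex, with edge values as
  coefficients. The relations at the ends \<open>i\<close> and \<open>j\<close> of the edge each
  contain just one form that is not assumed to vanish, and its coefficient is, up to sign, the
  nonzero value on that edge.\<close>

lemma face_form_zero_if_two_zero:
  assumes c: "ptolemy_assignment T c" and \<Delta>: "\<Delta> \<in> tets T" and ij: "i \<noteq> j"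
    and zero: "\<And>k. k \<noteq> i \<Longrightarrow> k \<noteq> j \<Longrightarrow> face_form T c \<Delta> k x = 0"
  shows "face_form T c \<Delta> k x = 0"
proof -
  define C where "C = (\<lambda>i j. c (oedge T \<Delta> i j))"
  \<comment> \<open>Both orientations are recorded because \<open>i\<close> and \<open>j\<close>
    come in either order, while the relations below use only increasing indices.\<close>
  have nz: "C i j \<noteq> 0" "C j i \<noteq> 0"
    using oedge_nonzero[OF c \<Delta>] ij by (auto simp: C_def)
  have P: "C 0 1 * C 2 3 - C 0 2 * C 1 3 + C 0 3 * C 1 2 = 0"
    using c \<Delta> by (auto simp: ptolemy_assignment_def C_def Let_def)
  define F0 where "F0 = C 2 3 * x 1 - C 1 3 * x 2 + C 1 2 * x 3"
  define F1 where "F1 = C 2 3 * x 0 - C 0 3 * x 2 + C 0 2 * x 3"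
  define F2 where "F2 = C 1 3 * x 0 - C 0 3 * x 1 + C 0 1 * x 3"
  define F3 where "F3 = C 1 2 * x 0 - C 0 2 * x 1 + C 0 1 * x 2"
  have form: "face_form T c \<Delta> 0 x = F0" "face_form T c \<Delta> 1 x = F1"
    "face_form T c \<Delta> 2 x = F2" "face_form T c \<Delta> 3 x = F3"
    by (simp_all add: face_form_def F0_def F1_def F2_def F3_def C_def Let_def)
  \<comment> \<open>The relation at vertex \<open>l\<close> combines the three forms
    \<open>Fk\<close> with \<open>k\<close> different from \<open>l\<close>; the coefficient of
    \<open>Fk\<close> is, up to sign, the value on the edge joining \<open>k\<close> and
    \<open>l\<close>. All coordinates other than \<open>x l\<close> cancel, and \<open>x l\<close>
    is left with the Ptolemy expression.\<close>
  have
    "C 0 1 * F1 - C 0 2 * F2 + C 0 3 * F3 = x 0 * (C 0 1 * C 2 3 - C 0 2 * C 1 3 + C 0 3 * C 1 2)"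
    "C 0 1 * F0 - C 1 2 * F2 + C 1 3 * F3 = x 1 * (C 0 1 * C 2 3 - C 0 2 * C 1 3 + C 0 3 * C 1 2)"
    "C 0 2 * F0 - C 1 2 * F1 + C 2 3 * F3 = x 2 * (C 0 1 * C 2 3 - C 0 2 * C 1 3 + C 0 3 * C 1 2)"
    "C 0 3 * F0 - C 1 3 * F1 + C 2 3 * F2 = x 3 * (C 0 1 * C 2 3 - C 0 2 * C 1 3 + C 0 3 * C 1 2)"
    by (simp_all add: F0_def F1_def F2_def F3_def algebra_simps)
  then have syzygies:
    "C 0 1 * F1 - C 0 2 * F2 + C 0 3 * F3 = 0"
    "C 0 1 * F0 - C 1 2 * F2 + C 1 3 * F3 = 0"
    "C 0 2 * F0 - C 1 2 * F1 + C 2 3 * F3 = 0"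
    "C 0 3 * F0 - C 1 3 * F1 + C 2 3 * F2 = 0"
    by (simp_all only: P mult_zero_right)
  \<comment> \<open>For each edge, the relations at its two ends give the two missing forms after
    division by the value on that edge.\<close>
  have dep:
    "C 0 1 \<noteq> 0 \<Longrightarrow> F2 = 0 \<Longrightarrow> F3 = 0 \<Longrightarrow> F0 = 0 \<and> F1 = 0"
    "C 0 2 \<noteq> 0 \<Longrightarrow> F1 = 0 \<Longrightarrow> F3 = 0 \<Longrightarrow> F0 = 0 \<and> F2 = 0"
    "C 0 3 \<noteq> 0 \<Longrightarrow> F1 = 0 \<Longrightarrow> F2 = 0 \<Longrightarrow> F0 = 0 \<and> F3 = 0"
    "C 1 2 \<noteq> 0 \<Longrightarrow> F0 = 0 \<Longrightarrow> F3 = 0 \<Longrightarrow> F1 = 0 \<and> F2 = 0"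
    "C 1 3 \<noteq> 0 \<Longrightarrow> F0 = 0 \<Longrightarrow> F2 = 0 \<Longrightarrow> F1 = 0 \<and> F3 = 0"
    "C 2 3 \<noteq> 0 \<Longrightarrow> F0 = 0 \<Longrightarrow> F1 = 0 \<Longrightarrow> F2 = 0 \<and> F3 = 0"
    using syzygies by simp_all
  have zero': "0 \<noteq> i \<Longrightarrow> 0 \<noteq> j \<Longrightarrow> F0 = 0" "1 \<noteq> i \<Longrightarrow> 1 \<noteq> j \<Longrightarrow> F1 = 0"
    "2 \<noteq> i \<Longrightarrow> 2 \<noteq> j \<Longrightarrow> F2 = 0" "3 \<noteq> i \<Longrightarrow> 3 \<noteq> j \<Longrightarrow> F3 = 0"
    using zero[of 0] zero[of 1] zero[of 2] zero[of 3] form by auto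
  have "F0 = 0 \<and> F1 = 0 \<and> F2 = 0 \<and> F3 = 0"
    using ij nz zero'
    by (cases i rule: exhaust_4_from_0; cases j rule: exhaust_4_from_0;
        simp; use dep in blast)
  then show ?thesis
    by (cases k rule: exhaust_4_from_0) (simp_all add: form)
qed

text \<open>Linearity in the last argument, in the shape needed to expand \<theta> over the
  indicators of the faces.\<close>

lemma face_form_sum:
  "face_form T c \<Delta> k (\<lambda>l. \<Sum>n\<in>A. g n * h n l) = (\<Sum>n\<in>A. g n * face_form T c \<Delta> k (h n))"
  by (simp add: face_form_def Let_def sum_distrib_left sum_distrib_right sum.distrib
      sum_subtractf algebra_simps)

text \<open>This replaces four equations per tetrahedron by two, as needed for a square system; the
  discarded ones follow tetrahedron by tetrahedron.\<close>

lemma super_ptolemy_iff_kept_equations: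
  assumes "ptolemy_assignment T c" "edge_choice T a"
  shows "super_ptolemy_assignment T c \<theta> \<longleftrightarrow>
    (\<forall>(\<Delta>, k) \<in> kept_equations T a. face_equation T c \<theta> \<Delta> k)"
proof
  assume kept: "\<forall>(\<Delta>, k) \<in> kept_equations T a. face_equation T c \<theta> \<Delta> k"
  have "face_form T c \<Delta> k (\<lambda>l. \<theta> (tface T \<Delta> l)) = 0" if "\<Delta> \<in> tets T" for \<Delta> k
    by (rule face_form_zero_if_two_zero[OF assms(1) that, of "fst (a \<Delta>)" "snd (a \<Delta>)"])
      (use assms(2) that kept in \<open>auto simp: edge_choice_def kept_equations_def face_equation_def\<close>)
  then show "super_ptolemy_assignment T c \<theta>"
    using assms(1) by (simp add: super_ptolemy_assignment_def face_equation_def)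
qed (auto simp: super_ptolemy_assignment_def kept_equations_def)

text \<open>Write \<theta> as a combination of indicators of the faces \<open>s n\<close> and use
  linearity. If two faces of \<Delta> are glued to each other, the indicator is 1 at both, in
  agreement with the added coefficients of the matrix.\<close>

lemma face_matrix_mult_vec:
  assumes s: "bij_betw s {..<2 * card (tets T)} (faces T)"
    and m: "m < 2 * card (tets T)" and r: "r m = (\<Delta>, k)" and \<Delta>: "\<Delta> \<in> tets T"
  shows "vec_index (face_matrix T c r s *\<^sub>v Matrix.vec (2 * card (tets T)) (\<lambda>n. \<theta> (s n))) m =
    face_form T c \<Delta> k (\<lambda>l. \<theta> (tface T \<Delta> l))"
proof -
  let ?I = "{..<2 * card (tets T)}"
  \<comment> \<open>Since \<open>s\<close> lists every face exactly once, a single index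
    contributes.\<close>
  have "(\<Sum>n\<in>?I. \<theta> (s n) * (if tface T \<Delta> l = s n then 1 else 0)) = \<theta> (tface T \<Delta> l)" for l
  proof -
    have "tface T \<Delta> l \<in> faces T"
      using \<Delta> by (auto simp: faces_def)
    moreover have "(\<Sum>n\<in>?I. \<theta> (s n) * (if tface T \<Delta> l = s n then 1 else 0)) =
        (\<Sum>f\<in>faces T. \<theta> f * (if tface T \<Delta> l = f then 1 else 0))"
      by (rule sum.reindex_bij_betw[OF s])
    moreover have "finite (faces T)"
      using s bij_betw_finite by blast
    ultimately show ?thesis
      by (simp add: if_distrib cong: if_cong)
  qed
  then have "face_form T c \<Delta> k (\<lambda>l. \<theta> (tface T \<Delta> l)) =
      (\<Sum>n\<in>?I. \<theta> (s n) * face_form T c \<Delta> k (\<lambda>l. if tface T \<Delta> l = s n then 1 else 0))"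
    by (simp flip: face_form_sum)
  then show ?thesis
    using m r by (simp add: face_matrix_def scalar_prod_def atLeast0LessThan mult.commute)
qed

text \<open>A square matrix over a field is singular iff it kills a nonzero vector, and through
  \<open>s\<close> the vectors of length \<open>n\<close> are the values of \<theta> on the
  faces.\<close>

lemma det_face_matrix_eq_0_iff:
  assumes c: "ptolemy_assignment T c" and a: "edge_choice T a"
    and r: "bij_betw r {..<2 * card (tets T)} (kept_equations T a)"
    and s: "bij_betw s {..<2 * card (tets T)} (faces T)"
  shows "Determinant.det (face_matrix T c r s) = 0 \<longleftrightarrow>
    (\<exists>\<theta>. super_ptolemy_assignment T c \<theta> \<and> (\<exists>f \<in> faces T. \<theta> f \<noteq> 0))"
proof -
  define n where "n = 2 * card (tets T)"
  let ?F = "face_matrix T c r s"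
  let ?v = "\<lambda>\<theta> :: 'a face \<Rightarrow> complex. Matrix.vec n (\<lambda>i. \<theta> (s i))"
  have F: "?F \<in> carrier_mat n n"
    by (simp add: face_matrix_def n_def)
  have r_img: "r ` {..<n} = kept_equations T a" and s_img: "s ` {..<n} = faces T"
    and s_inj: "inj_on s {..<n}"
    using r s by (auto simp: bij_betw_def n_def)
  have entry: "vec_index (?F *\<^sub>v ?v \<theta>) m = 0 \<longleftrightarrow> (case r m of (\<Delta>, k) \<Rightarrow> face_equation T c \<theta> \<Delta> k)"
    if "m < n" for \<theta> m
  proof -
    obtain \<Delta> k where rm: "r m = (\<Delta>, k)" by force
    with that r_img have "(\<Delta>, k) \<in> kept_equations T a"
      by (metis imageI lessThan_iff)
    then have "\<Delta> \<in> tets T"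
      by (simp add: kept_equations_def)
    then show ?thesis
      using face_matrix_mult_vec[where r = r and m = m and c = c and \<theta> = \<theta>, OF s _ rm] that rm
      by (simp add: n_def face_equation_def)
  qed
  \<comment> \<open>Every kept equation occurs as a row because \<open>r\<close> is onto.\<close>
  have kernel: "?F *\<^sub>v ?v \<theta> = 0\<^sub>v n \<longleftrightarrow> super_ptolemy_assignment T c \<theta>" for \<theta>
  proof -
    have "?F *\<^sub>v ?v \<theta> = 0\<^sub>v n \<longleftrightarrow> (\<forall>m<n. vec_index (?F *\<^sub>v ?v \<theta>) m = 0)"
      using F by (auto simp: vec_eq_iff)
    also have "\<dots> \<longleftrightarrow> (\<forall>m<n. case r m of (\<Delta>, k) \<Rightarrow> face_equation T c \<theta> \<Delta> k)"
      by (intro iff_allI imp_cong refl entry)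
    also have "\<dots> \<longleftrightarrow> super_ptolemy_assignment T c \<theta>"
      unfolding super_ptolemy_iff_kept_equations[OF c a] r_img[symmetric]
      by (simp only: ball_simps lessThan_iff Ball_def[of "{..<n}"])
    finally show ?thesis .
  qed
  have nonzero: "?v \<theta> \<noteq> 0\<^sub>v n \<longleftrightarrow> (\<exists>f \<in> faces T. \<theta> f \<noteq> 0)" for \<theta>
    unfolding s_img[symmetric] by (auto simp: vec_eq_iff)
  \<comment> \<open>The witness transports \<open>v\<close> back along the inverse of
    \<open>s\<close>; its values off \<open>faces T\<close> are irrelevant.\<close>
  have coords: "\<exists>\<theta>. v = ?v \<theta>" if "v \<in> carrier_vec n" for v
    using that s_inj
    by (intro exI[of _ "\<lambda>f. vec_index v (the_inv_into {..<n} s f)"])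
      (auto simp: vec_eq_iff the_inv_into_f_f)
  have "Determinant.det ?F = 0 \<longleftrightarrow> (\<exists>v\<in>carrier_vec n. v \<noteq> 0\<^sub>v n \<and> ?F *\<^sub>v v = 0\<^sub>v n)"
    using det_0_iff_vec_prod_zero[OF F] by blast
  also have "\<dots> \<longleftrightarrow> (\<exists>\<theta>. ?v \<theta> \<noteq> 0\<^sub>v n \<and> ?F *\<^sub>v ?v \<theta> = 0\<^sub>v n)"
    using coords by (metis vec_carrier)
  finally show ?thesis
    unfolding kernel nonzero by blast
qed

text \<open>The determinant is multiplied only by inverses of nonzero edge values; reversing an edge
  merely changes the sign of its value.\<close>

lemma one_loop_at_1_eq_0_iff:
  assumes c: "ptolemy_assignment T c" and a: "edge_choice T a" and u: "edge_orientation T u"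
  shows "one_loop_at_1 T c a u r s = 0 \<longleftrightarrow> Determinant.det (face_matrix T c r s) = 0"
proof -
  have "c (u E) \<noteq> 0" if E: "E \<in> edges T" for E
  proof -
    obtain e where "e \<in> oedges T" "E = {e, rev_edge e}"
      using E by (auto simp: edges_def)
    moreover from this have "u E = e \<or> u E = rev_edge e"
      using u E by (auto simp: edge_orientation_def)
    ultimately show ?thesis
      using c by (auto simp: ptolemy_assignment_def)
  qed
  \<comment> \<open>Finiteness of \<open>edges T\<close> is not derived here: over an infinite set
    the product is 1 by convention, hence also nonzero.\<close>
  then have "(\<Prod>E \<in> edges T. c (u E)) \<noteq> 0"
    by (metis (no_types, lifting) prod.infinite prod_zero_iff zero_neq_one)
  moreover have "c (oedge T \<Delta> (fst (a \<Delta>)) (snd (a \<Delta>))) \<noteq> 0" if "\<Delta> \<in> tets T" for \<Delta>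
    using oedge_nonzero[OF c that] a that by (auto simp: edge_choice_def)
  then have "(\<Prod>\<Delta> \<in> tets T. 1 / c (oedge T \<Delta> (fst (a \<Delta>)) (snd (a \<Delta>)))) \<noteq> 0"
    by (cases "finite (tets T)") auto
  ultimately show ?thesis
    by (simp add: one_loop_at_1_def)
qed

theorem theorem3p6:
  fixes M :: "'a topology" and T :: "'t triangulation" and N :: nat
    and c :: "'t oedge \<Rightarrow> complex"
    and a :: "'t \<Rightarrow> 4 \<times> 4" and u :: "'t oedge set \<Rightarrow> 't oedge"
    and r :: "nat \<Rightarrow> 't \<times> 4" and s :: "nat \<Rightarrow> 't face"
  assumes "compact_3manifold_with_boundary M" and "manifold_boundary M \<noteq> {}"
    and "ideal_triangulation_of T (subtopology M (manifold_interior M))"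
    and "card (tets T) = N" and "card (edges T) = N"
    and "ptolemy_assignment T c"
    and "edge_choice T a" and "edge_orientation T u"
    and "bij_betw r {..<2 * N} (kept_equations T a)"
    and "bij_betw s {..<2 * N} (faces T)"
  shows "(\<exists>\<theta>. super_ptolemy_assignment T c \<theta> \<and> (\<exists>f \<in> faces T. \<theta> f \<noteq> 0)) \<longleftrightarrow>
    one_loop_at_1 T c a u r s = 0"
  using det_face_matrix_eq_0_iff[of T c a r s] one_loop_at_1_eq_0_iff[of T c a u r s] assms by blast

end
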